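(* Let $n\ge 1$ be an integer. For all real numbers $a_1,\dots,a_n$, not all zero, all real $x>0$, and all real $\alpha>\cos\frac{\pi}{n+1}$, $$\sum_{j=0}^{n-1}\Big(\sum_{k=0}^{j}\frac{x^k}{k!}\,a_{n-j+k}\Big)^2< e^{2x\alpha}\sum_{j=1}^n a_j^2 .$$ *)

theory Defs
  imports Complex_Main
begin

end

theory Submission
  imports Defs
begin

text \<open>
  Let \<open>u j t\<close> be the inner sum with \<open>t\<close> in place of \<open>x\<close>. Then \<open>u j\<close> has derivative
  \<open>u (j - 1)\<close> and \<open>u 0\<close> is constant, so the energy \<open>E\<close>, the sum of the \<open>(u j)\<^sup>2\<close>, has derivative
  twice the sum of the \<open>u j * u (j - 1)\<close>. This is the quadratic form of the adjacency matrix of the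
  path on \<open>n\<close> vertices, whose largest eigenvalue is \<open>2 * cos (pi / (n + 1))\<close>. Hence
  \<open>E t * exp (- 2 * t * cos (pi / (n + 1)))\<close> is nonincreasing.
\<close>

text \<open>Each term with \<open>k > 0\<close> loses one power and one factorial factor, while
  \<open>b 0\<close> is constant. This yields the recursion for the derivatives of the
  \<open>u j\<close>.\<close>

lemma has_real_derivative_exp_partial_sum:
  fixes b :: "nat \<Rightarrow> real"
  shows "((\<lambda>t. \<Sum>k = 0..Suc j. t ^ k / fact k * b k) has_real_derivative
           (\<Sum>k = 0..j. t ^ k / fact k * b (Suc k))) (at t)"
proof -
  have "((\<lambda>t. \<Sum>k = 0..j. t ^ Suc k / fact (Suc k) * b (Suc k)) has_real_derivative
           (\<Sum>k = 0..j. t ^ k / fact k * b (Suc k))) (at t)"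
  proof (rule DERIV_sum)
    fix k
    have "((\<lambda>t. t ^ Suc k / fact (Suc k) * b (Suc k)) has_real_derivative
            (real (Suc k) * t ^ k / fact (Suc k) * b (Suc k))) (at t)"
      by (auto intro!: derivative_eq_intros simp del: fact_Suc power_Suc)
    moreover have "real (Suc k) * t ^ k / fact (Suc k) = t ^ k / fact k"
      by (simp del: of_nat_Suc)
    ultimately show "((\<lambda>t. t ^ Suc k / fact (Suc k) * b (Suc k)) has_real_derivative
            (t ^ k / fact k * b (Suc k))) (at t)"
      by simp
  qed
  then have "((\<lambda>t. b 0 + (\<Sum>k = 0..j. t ^ Suc k / fact (Suc k) * b (Suc k))) has_real_derivative
           (0 + (\<Sum>k = 0..j. t ^ k / fact k * b (Suc k)))) (at t)"
    by (intro DERIV_add DERIV_const)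
  moreover have "(\<lambda>t. \<Sum>k = 0..Suc j. t ^ k / fact k * b k)
      = (\<lambda>t. b 0 + (\<Sum>k = 0..j. t ^ Suc k / fact (Suc k) * b (Suc k)))"
    by (subst sum.atLeast0_atMost_Suc_shift) (simp add: fun_eq_iff)
  ultimately show ?thesis by (simp only: add_0)
qed

text \<open>The eigenvector equation of the path at an inner vertex, with eigenvalue
  \<open>2 * cos \<theta>\<close>.\<close>

lemma sin_three_term:
  "sin ((y + 2) * \<theta>) + sin (y * \<theta>) = 2 * cos \<theta> * sin ((y + 1) * \<theta>)" for y \<theta> :: real
proof -
  have "(y + 2) * \<theta> = (y + 1) * \<theta> + \<theta>" "y * \<theta> = (y + 1) * \<theta> - \<theta>"
    by (simp_all add: algebra_simps)
  then show ?thesis by (simp only: sin_add sin_diff) simp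
qed

text \<open>
  The numbers \<open>sin ((j + 1) * \<theta>)\<close> are the Perron eigenvector of the path; the extra term on the left
  is the remainder left over when the square is completed edge by edge.
\<close>
lemma path_form_partial:
  fixes u :: "nat \<Rightarrow> real"
  assumes "\<And>j. j \<le> m \<Longrightarrow> sin (real (Suc j) * \<theta>) > 0"
  shows "2 * (\<Sum>j<m. u j * u (Suc j)) + sin (real (m + 2) * \<theta>) / sin (real (m + 1) * \<theta>) * (u m)\<^sup>2
          \<le> 2 * cos \<theta> * (\<Sum>j\<le>m. (u j)\<^sup>2)"
  using assms
proof (induction m)
  case 0
  then have "sin \<theta> > 0" by (metis le_refl mult_1 of_nat_1 One_nat_def)
  then show ?case by (simp add: sin_double)
next
  case (Suc m)
  define p where "p = sin (real (m + 1) * \<theta>)"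
  define q where "q = sin (real (m + 2) * \<theta>)"
  define r where "r = sin (real (m + 3) * \<theta>)"
  have pos: "p > 0" "q > 0"
    using Suc.prems[of m] Suc.prems[of "Suc m"] by (simp_all add: p_def q_def)
  have "r + p = 2 * cos \<theta> * q"
    using sin_three_term[of "real (m + 1)" \<theta>] by (simp add: p_def q_def r_def add.commute)
  \<comment> \<open>The weight of the new vertex splits: \<open>p / q\<close> pays for the edge back
    to \<open>m\<close>, and \<open>r / q\<close> is the next remainder.\<close>
  then have rq: "2 * cos \<theta> = r / q + p / q"
    using pos by (simp add: field_simps)
  have IH: "2 * (\<Sum>j<m. u j * u (Suc j)) + q / p * (u m)\<^sup>2 \<le> 2 * cos \<theta> * (\<Sum>j\<le>m. (u j)\<^sup>2)"
    using Suc unfolding p_def q_def by simp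
  \<comment> \<open>The square vanishes on the eigenvector, and its term in \<open>u m\<close> is
    exactly the old remainder.\<close>
  have "0 \<le> (q * u m - p * u (Suc m))\<^sup>2 / (p * q)"
    using pos by simp
  also have "\<dots> = q / p * (u m)\<^sup>2 + p / q * (u (Suc m))\<^sup>2 - 2 * (u m * u (Suc m))"
    using pos by (simp add: field_simps power2_eq_square)
  finally have "2 * (u m * u (Suc m)) + r / q * (u (Suc m))\<^sup>2
      \<le> q / p * (u m)\<^sup>2 + 2 * cos \<theta> * (u (Suc m))\<^sup>2"
    unfolding rq by (simp add: algebra_simps)
  with IH have "2 * (\<Sum>j<Suc m. u j * u (Suc j)) + r / q * (u (Suc m))\<^sup>2
      \<le> 2 * cos \<theta> * (\<Sum>j\<le>Suc m. (u j)\<^sup>2)"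
    by (simp add: algebra_simps)
  then show ?case by (simp add: q_def r_def numeral_eq_Suc)
qed

text \<open>The path has \<open>m + 1\<close> vertices. At the angle \<open>pi / (m + 2)\<close> the
  sines at all of them are positive and the next one is zero, so the remainder disappears.\<close>

lemma path_form_le:
  fixes u :: "nat \<Rightarrow> real"
  shows "(\<Sum>j<m. u j * u (Suc j)) \<le> cos (pi / real (m + 2)) * (\<Sum>j\<le>m. (u j)\<^sup>2)"
proof -
  define \<theta> where "\<theta> = pi / real (m + 2)"
  have "sin (real (Suc j) * \<theta>) > 0" if "j \<le> m" for j
  proof (rule sin_gt_zero)
    show "0 < real (Suc j) * \<theta>" by (simp add: \<theta>_def)
    have "real (Suc j) * \<theta> < real (m + 2) * \<theta>"
      using that by (intro mult_strict_right_mono) (simp_all add: \<theta>_def)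
    then show "real (Suc j) * \<theta> < pi" by (simp add: \<theta>_def)
  qed
  moreover have "real (m + 2) * \<theta> = pi" by (simp add: \<theta>_def)
  then have "sin (real (m + 2) * \<theta>) = 0" by (simp only: sin_pi)
  ultimately show ?thesis
    using path_form_partial[of m \<theta> u] by (simp add: \<theta>_def)
qed

text \<open>A Gronwall estimate: the integrating factor \<open>exp (- c * t)\<close> makes the
  product nonincreasing.\<close>

lemma exp_growth_bound:
  fixes f f' :: "real \<Rightarrow> real"
  assumes "\<And>t. (f has_real_derivative f' t) (at t)"
    and "\<And>t. f' t \<le> c * f t"
    and "0 \<le> x"
  shows "f x \<le> exp (c * x) * f 0"
proof -
  have "((\<lambda>t. f t * exp (- c * t)) has_real_derivative (f' t - c * f t) * exp (- c * t)) (at t)" for t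
    by (rule derivative_eq_intros assms(1) refl | simp add: algebra_simps)+
  moreover have "(f' t - c * f t) * exp (- c * t) \<le> 0" for t
    using assms(2)[of t] by (simp add: mult_le_0_iff)
  ultimately have "f x * exp (- c * x) \<le> f 0 * exp (- c * 0)"
    by (intro DERIV_nonpos_imp_nonincreasing[OF assms(3)]) blast
  then show ?thesis by (simp add: exp_minus field_simps)
qed

theorem theorem4p2:
  fixes n :: nat and a :: "nat \<Rightarrow> real" and x \<alpha> :: real
  assumes "n \<ge> 1"
    and "\<exists>j\<in>{1..n}. a j \<noteq> 0"
    and "x > 0"
    and "\<alpha> > cos (pi / (real n + 1))"
  shows "(\<Sum>j = 0..n - 1. (\<Sum>k = 0..j. x ^ k / fact k * a (n - j + k))\<^sup>2)
           < exp (2 * x * \<alpha>) * (\<Sum>j = 1..n. (a j)\<^sup>2)"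
proof -
  obtain m where n: "n = Suc m" using assms(1) by (cases n) auto
  define c where "c = cos (pi / (real n + 1))"
  define u where "u j t = (\<Sum>k = 0..j. t ^ k / fact k * a (n - j + k))" for j and t :: real
  define E where "E t = (\<Sum>j\<le>m. (u j t)\<^sup>2)" for t
  \<comment> \<open>Splitting off the constant \<open>u 0\<close> leaves indices that all have a
    predecessor.\<close>
  have E_alt: "E t = (u 0 t)\<^sup>2 + (\<Sum>j<m. (u (Suc j) t)\<^sup>2)" for t
    unfolding E_def by (subst sum.atMost_shift) simp
  have u0: "(u 0 has_real_derivative 0) (at t)" for t
    unfolding u_def by simp
  have uS: "(u (Suc j) has_real_derivative u j t) (at t)" if "j < m" for j t
  proof -
    \<comment> \<open>Subtraction is truncated; \<open>j < m\<close> ensures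
      \<open>Suc j \<le> n\<close>.\<close>
    have shift: "n - Suc j + Suc k = n - j + k" for k using that n by simp
    show ?thesis
      unfolding u_def using has_real_derivative_exp_partial_sum[of "\<lambda>k. a (n - Suc j + k)" j t]
      by (simp only: shift)
  qed
  have "(E has_real_derivative 2 * (\<Sum>j<m. u j t * u (Suc j) t)) (at t)" for t
  proof -
    have "((\<lambda>t. (u 0 t)\<^sup>2 + (\<Sum>j<m. (u (Suc j) t)\<^sup>2)) has_real_derivative
             0 + (\<Sum>j<m. 2 * (u j t * u (Suc j) t))) (at t)"
      by (intro DERIV_add DERIV_sum; (rule derivative_eq_intros u0 uS)+) auto
    then show ?thesis by (simp add: E_alt[abs_def] sum_distrib_left)
  qed
  moreover have "2 * (\<Sum>j<m. u j t * u (Suc j) t) \<le> 2 * c * E t" for t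
    using path_form_le[of "\<lambda>j. u j t" m] by (simp add: E_def c_def n add.commute)
  ultimately have Ex: "E x \<le> exp (2 * c * x) * E 0"
    using assms(3) by (intro exp_growth_bound) auto
  have E0: "E 0 = (\<Sum>j = 1..n. (a j)\<^sup>2)"
  proof -
    have "u j 0 = a (n - j)" for j
    proof -
      \<comment> \<open>Only \<open>k = 0\<close> survives at time 0, where
        \<open>0 ^ 0 = 1\<close>.\<close>
      have "u j 0 = (\<Sum>k\<in>{0}. 0 ^ k / fact k * a (n - j + k))"
        unfolding u_def by (rule sum.mono_neutral_right) auto
      then show ?thesis by simp
    qed
    then have "E 0 = (\<Sum>j\<le>m. (a (n - j))\<^sup>2)" by (simp add: E_def)
    also have "\<dots> = (\<Sum>j = 1..n. (a j)\<^sup>2)"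
      by (rule sum.reindex_bij_witness[of _ "\<lambda>j. n - j" "\<lambda>j. n - j"]) (auto simp: n)
    finally show ?thesis .
  qed
  have pos: "(\<Sum>j = 1..n. (a j)\<^sup>2) > 0"
    using assms(2) by (auto intro: sum_pos2)
  \<comment> \<open>The energy bound is not strict; strictness comes from
    \<open>\<alpha> > c\<close> together with \<open>x > 0\<close> and a nonzero
    \<open>a j\<close>.\<close>
  have "exp (2 * c * x) < exp (2 * x * \<alpha>)"
    using assms(3,4) by (simp add: c_def)
  then have "exp (2 * c * x) * (\<Sum>j = 1..n. (a j)\<^sup>2) < exp (2 * x * \<alpha>) * (\<Sum>j = 1..n. (a j)\<^sup>2)"
    using pos by (rule mult_strict_right_mono)
  with Ex have "E x < exp (2 * x * \<alpha>) * (\<Sum>j = 1..n. (a j)\<^sup>2)"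
    unfolding E0 by linarith
  then show ?thesis
    by (simp add: E_def u_def n atLeast0AtMost)
qed

end
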